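(* A (not necessarily closed) subgroup $G\subset O(n)$ is irreducible if and only if the Hausdorff distance $r_v$ between the orbit of $v$ under $G$ and the unit sphere satisfies $r_v<\sqrt{2}$ for every $v\in S_{n-1}$.
   Context: $\mathbb{R}^n$ carries the canonical inner product and norm $\|\cdot\|$; $S_{n-1}=\{v\in\mathbb{R}^n : \|v\|=1\}$. For a subgroup $G\subset O(n)$ and $v\in S_{n-1}$ put $h_v(w):=\inf_{g\in G}\|w-g(v)\|$ and $r_v:=\sup_{\|w\|=1}h_v(w)$ (the maximin value, which is the Hausdorff distance between the orbit $\{g(v) : g\in G\}$ and the sphere $S_{n-1}$). $G$ is irreducible if the only $G$-invariant linear subspaces of $\mathbb{R}^n$ are $\{0\}$ and $\mathbb{R}^n$; otherwise it is reducible.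
   Formalization: The case n = 1 with G the trivial group is excluded: there G is irreducible, yet r_v = 2 for both unit vectors v, so the claim as stated fails. *)

theory Defs
  imports "HOL-Analysis.Analysis" "HOL-Algebra.Group"
begin

definition orthogonal_group :: "(real^'n^'n) monoid" where
  "orthogonal_group = \<lparr>carrier = {A. orthogonal_matrix A}, mult = (**), one = mat 1\<rparr>"

lemma group_orthogonal_group: "group (orthogonal_group :: (real^'n^'n) monoid)"
proof (rule groupI)
  fix A :: "real^'n^'n"
  assume "A \<in> carrier orthogonal_group"
  then show "\<exists>B\<in>carrier orthogonal_group. B \<otimes>\<^bsub>orthogonal_group\<^esub> A = \<one>\<^bsub>orthogonal_group\<^esub>"
    by (intro bexI[of _ "transpose A"])
       (auto simp: orthogonal_group_def orthogonal_matrix_def)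
qed (auto simp: orthogonal_group_def orthogonal_matrix_mul orthogonal_matrix_id matrix_mul_assoc)

definition irreducible_action :: "(real^'n^'n) set \<Rightarrow> bool" where
  "irreducible_action G \<longleftrightarrow>
     (\<forall>V. subspace V \<and> (\<forall>A\<in>G. (\<lambda>x. A *v x) ` V \<subseteq> V) \<longrightarrow> V = {0} \<or> V = UNIV)"

definition orbit_dist :: "(real^'n^'n) set \<Rightarrow> real^'n \<Rightarrow> real^'n \<Rightarrow> real" where
  "orbit_dist G v w = (INF A\<in>G. norm (w - A *v v))"

(* For v on the unit sphere the orbit lies in the sphere, so the other one-sided
   distance vanishes and this supremum is the Hausdorff distance between the orbit
   and the sphere. The real INF and SUP are genuine for a subgroup G of O(n): G is nonempty,
   norms are nonnegative, and orbit_dist G v w <= norm w + norm v. *)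
definition maximin_value :: "(real^'n^'n) set \<Rightarrow> real^'n \<Rightarrow> real" where
  "maximin_value G v = (SUP w\<in>sphere 0 1. orbit_dist G v w)"

end

theory Submission
  imports Defs
begin

text \<open>If a subspace is invariant, a unit vector in it and a unit vector orthogonal to it realise
  the value \<open>sqrt 2\<close>. Conversely, if the maximin value at \<open>v\<close> is at least \<open>sqrt 2\<close>, the compact
  invariant set \<open>S\<close> of unit vectors making a non-acute angle with every point of the orbit of \<open>v\<close> is
  nonempty. The point of least norm in the convex hull of \<open>S\<close> is fixed by the group, hence vanishes
  for an irreducible action. In a representation of 0 as a convex combination of points of \<open>S\<close>
  every point with positive weight is orthogonal to the whole orbit; the vectors orthogonal to the
  orbit then form a proper nonzero invariant subspace.\<close>

lemma subgroup_orthogonal_groupD: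
  fixes G :: "(real^'n^'n) set"
  assumes "subgroup G orthogonal_group"
  shows "A \<in> G \<Longrightarrow> orthogonal_matrix A"
    and "mat 1 \<in> G"
    and "A \<in> G \<Longrightarrow> B \<in> G \<Longrightarrow> A ** B \<in> G"
    and "A \<in> G \<Longrightarrow> transpose A \<in> G"
proof -
  interpret group "orthogonal_group :: (real^'n^'n) monoid" by (rule group_orthogonal_group)
  show orth: "orthogonal_matrix A" if "A \<in> G" for A
    using subgroup.subset[OF assms] that by (auto simp: orthogonal_group_def)
  show "mat 1 \<in> G" using subgroup.one_closed[OF assms] by (simp add: orthogonal_group_def)
  show "A ** B \<in> G" if "A \<in> G" "B \<in> G"
    using subgroup.m_closed[OF assms that] by (simp add: orthogonal_group_def)
  show "transpose A \<in> G" if "A \<in> G"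
  proof -
    have "inv\<^bsub>orthogonal_group\<^esub> A = transpose A"
      by (rule inv_equality)
         (use orth[OF that] in \<open>auto simp: orthogonal_group_def orthogonal_matrix_def\<close>)
    then show ?thesis using subgroup.m_inv_closed[OF assms that] by simp
  qed
qed

lemma orthogonal_matrix_norm:
  fixes A :: "real^'n^'n"
  assumes "orthogonal_matrix A"
  shows "norm (A *v x) = norm x"
proof -
  have "orthogonal_transformation ((*v) A)"
    using assms by (simp add: orthogonal_transformation_matrix)
  then show ?thesis by (rule orthogonal_transformation_norm)
qed

lemma inner_matrix_vector_transpose:
  fixes A :: "real^'n^'m"
  shows "(A *v x) \<bullet> y = x \<bullet> (transpose A *v y)"
  by (metis dot_lmul_matrix inner_commute transpose_matrix_vector)

lemma orbit_dist_infdist: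
  assumes "G \<noteq> {}"
  shows "orbit_dist G v w = infdist w ((\<lambda>A. A *v v) ` G)"
  using assms by (simp add: orbit_dist_def infdist_def dist_norm image_image)

lemma orbit_dist_le:
  assumes "A \<in> G"
  shows "orbit_dist G v w \<le> norm (w - A *v v)"
  unfolding orbit_dist_def using assms by (intro cINF_lower bdd_belowI2[where m = 0]) auto

text \<open>Distance to the orbit is continuous and the sphere is compact, so a maximum exists. The
  supremum can thus be replaced by the value at one unit vector \<open>w\<close>.\<close>

lemma maximin_value_attained:
  fixes G :: "(real^'n^'n) set"
  assumes "G \<noteq> {}"
  obtains w where "norm w = 1" "maximin_value G v = orbit_dist G v w"
    "\<And>u. norm u = 1 \<Longrightarrow> orbit_dist G v u \<le> orbit_dist G v w"
proof -
  have "continuous_on (sphere 0 1) (orbit_dist G v)"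
    unfolding orbit_dist_infdist[OF assms] by (intro continuous_on_infdist continuous_on_id)
  then obtain w where w: "w \<in> sphere 0 1" "\<forall>u\<in>sphere 0 1. orbit_dist G v u \<le> orbit_dist G v w"
    using continuous_attains_sup[OF compact_sphere, of 0 1 "orbit_dist G v"] by auto
  have "maximin_value G v = orbit_dist G v w"
    unfolding maximin_value_def using w by (intro cSup_eq_maximum) auto
  with w show thesis by (intro that) auto
qed

text \<open>The squared distance of two unit vectors is 2 - 2 (\<open>x \<bullet> y\<close>), so the
  threshold \<open>sqrt 2\<close> separates acute angles from the others.\<close>

lemma norm_diff_unit_vectors_ge_sqrt2_iff:
  fixes x y :: "'a::real_inner"
  assumes "norm x = 1" "norm y = 1"
  shows "sqrt 2 \<le> norm (x - y) \<longleftrightarrow> x \<bullet> y \<le> 0"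
proof -
  have "x \<bullet> x = 1" "y \<bullet> y = 1" using assms by (auto simp: norm_eq_sqrt_inner)
  then show ?thesis
    by (simp add: norm_eq_sqrt_inner inner_diff_left inner_diff_right inner_commute)
qed

lemma reducible_maximin_value_ge:
  fixes G :: "(real^'n^'n) set"
  assumes "subgroup G orthogonal_group" "\<not> irreducible_action G"
  obtains v where "norm v = 1" "sqrt 2 \<le> maximin_value G v"
proof -
  note G = subgroup_orthogonal_groupD[OF assms(1)]
  from assms(2) obtain V where V: "subspace V" "\<And>A x. A \<in> G \<Longrightarrow> x \<in> V \<Longrightarrow> A *v x \<in> V"
    "V \<noteq> {0}" "V \<noteq> UNIV"
    unfolding irreducible_action_def by blast
  obtain a where a: "a \<in> V" "a \<noteq> 0" using V subspace_0 by blast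
  \<comment> \<open>The strict inequality of dimensions yields a nonzero vector orthogonal to
    \<open>V\<close>.\<close>
  have "dim V < DIM(real^'n)"
    using V(1,4) dim_eq_full[of V] dim_subset_UNIV[of V] span_eq_iff[of V]
    by (auto simp: order_less_le simp del: span_eq_iff)
  then obtain b where b: "b \<noteq> 0" "\<And>y. y \<in> V \<Longrightarrow> orthogonal b y"
    by (metis orthogonal_to_subspace_exists span_superset subsetD)
  define v where "v = a /\<^sub>R norm a"
  define w where "w = b /\<^sub>R norm b"
  have v: "v \<in> V" "norm v = 1" using a V by (auto simp: v_def subspace_mul)
  have w: "norm w = 1" "\<And>y. y \<in> V \<Longrightarrow> w \<bullet> y = 0"
    using b by (auto simp: w_def orthogonal_def)
  \<comment> \<open>By invariance the orbit of \<open>v\<close> stays in \<open>V\<close>, and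
    \<open>w\<close> is orthogonal to all of \<open>V\<close>.\<close>
  have "sqrt 2 \<le> norm (w - A *v v)" if "A \<in> G" for A
    using that v w V G by (simp add: norm_diff_unit_vectors_ge_sqrt2_iff orthogonal_matrix_norm)
  then have "sqrt 2 \<le> orbit_dist G v w"
    unfolding orbit_dist_def using G by (intro cINF_greatest) auto
  moreover obtain u where "maximin_value G v = orbit_dist G v u"
      "\<And>u'. norm u' = 1 \<Longrightarrow> orbit_dist G v u' \<le> orbit_dist G v u"
    using G(2) maximin_value_attained[of G v] by blast
  ultimately have "sqrt 2 \<le> maximin_value G v" using w by fastforce
  with v show thesis by (intro that)
qed

text \<open>A nonzero fixed vector spans an invariant line. Irreducibility makes this line the whole
  space, so every \<open>A\<close> in \<open>G\<close> is the identity: the trivial group in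
  dimension 1, which the second hypothesis excludes.\<close>

lemma irreducible_fixed_vector_eq_0:
  fixes G :: "(real^'n^'n) set"
  assumes "subgroup G orthogonal_group" "CARD('n) \<ge> 2 \<or> G \<noteq> {mat 1}" "irreducible_action G"
    and fixed: "\<And>A. A \<in> G \<Longrightarrow> A *v c = c"
  shows "c = 0"
proof (rule ccontr)
  assume "c \<noteq> 0"
  have "(\<lambda>x. A *v x) ` span {c} \<subseteq> span {c}" if "A \<in> G" for A
    using fixed[OF that] by (auto simp: span_singleton matrix_vector_mult_scaleR)
  then have full: "span {c} = UNIV"
    using assms(3) \<open>c \<noteq> 0\<close> span_base[of c "{c}"] unfolding irreducible_action_def
    by (metis singletonD singletonI subspace_span)
  have "CARD('n) = dim (span {c})" unfolding full by simp
  also have "\<dots> \<le> 1" using dim_le_card[of "span {c}" "{c}"] by simp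
  finally have "G \<noteq> {mat 1}" using assms(2) by linarith
  moreover have "A = mat 1" if "A \<in> G" for A
  proof -
    have "A *v x = x" for x
    proof -
      obtain k where "x = k *\<^sub>R c" using full by (auto simp: span_singleton)
      then show ?thesis using fixed[OF that] by (simp add: matrix_vector_mult_scaleR)
    qed
    then show ?thesis by (simp add: matrix_eq)
  qed
  ultimately show False using subgroup_orthogonal_groupD(2)[OF assms(1)] by blast
qed

text \<open>Orthogonal maps preserve the norm, so they send the point of \<open>K\<close> nearest to
  0 to another nearest point; convexity makes that point unique.\<close>

lemma compact_convex_invariant_fixed_point:
  fixes G :: "(real^'n^'n) set"
  assumes "\<And>A. A \<in> G \<Longrightarrow> orthogonal_matrix A"
    and "compact K" "convex K" "K \<noteq> {}"
    and "\<And>A x. A \<in> G \<Longrightarrow> x \<in> K \<Longrightarrow> A *v x \<in> K"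
  obtains c where "c \<in> K" "\<And>A. A \<in> G \<Longrightarrow> A *v c = c"
proof -
  define c where "c = closest_point K 0"
  have K: "closed K" using assms compact_imp_closed by blast
  have c: "c \<in> K" unfolding c_def using K assms by (intro closest_point_in_set)
  moreover have "A *v c = c" if "A \<in> G" for A
  proof -
    have "\<forall>z\<in>K. dist 0 (A *v c) \<le> dist 0 z"
      using closest_point_le[OF K, of _ 0] assms(1)[OF that]
      by (simp add: orthogonal_matrix_norm c_def)
    then show ?thesis
      unfolding c_def using closest_point_unique[OF assms(3) K] assms(5) that c c_def by metis
  qed
  ultimately show thesis by (rule that)
qed

lemma convex_hull_nonpos_zero:
  assumes "0 \<in> convex hull S" "\<And>x b. x \<in> S \<Longrightarrow> b \<in> B \<Longrightarrow> x \<bullet> b \<le> 0"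
  obtains x where "x \<in> S" "\<And>b. b \<in> B \<Longrightarrow> x \<bullet> b = 0"
proof -
  from assms(1) obtain T u where T: "finite T" "T \<subseteq> S" "\<forall>x\<in>T. 0 \<le> u x" "sum u T = 1"
      "(\<Sum>x\<in>T. u x *\<^sub>R x) = 0"
    unfolding convex_hull_explicit by auto
  \<comment> \<open>The weights sum to 1, so one is nonzero. This \<open>x\<close> is chosen before
    \<open>b\<close> and serves every \<open>b\<close> at once.\<close>
  obtain x where x: "x \<in> T" "u x \<noteq> 0"
    using T(4) by (metis sum.neutral zero_neq_one)
  have "x \<bullet> b = 0" if "b \<in> B" for b
  proof -
    \<comment> \<open>Pairing the combination with \<open>b\<close> gives nonnegative terms with sum
      0, so each term vanishes.\<close>
    have "(\<Sum>y\<in>T. u y * - (y \<bullet> b)) = - ((\<Sum>y\<in>T. u y *\<^sub>R y) \<bullet> b)"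
      by (simp add: inner_sum_left sum_negf)
    also have "\<dots> = 0" using T by simp
    finally have "\<forall>y\<in>T. u y * - (y \<bullet> b) = 0"
      using T assms(2) that
      by (subst (asm) sum_nonneg_eq_0_iff) (auto intro!: mult_nonneg_nonneg simp: mult_le_0_iff)
    with x show ?thesis by auto
  qed
  with x T that show thesis by blast
qed

lemma irreducible_maximin_value_less:
  fixes G :: "(real^'n^'n) set"
  assumes "subgroup G orthogonal_group" "CARD('n) \<ge> 2 \<or> G \<noteq> {mat 1}" "irreducible_action G"
    and v: "norm v = 1"
  shows "maximin_value G v < sqrt 2"
proof (rule ccontr)
  assume *: "\<not> maximin_value G v < sqrt 2"
  note G = subgroup_orthogonal_groupD[OF assms(1)]
  obtain w where w: "norm w = 1" "maximin_value G v = orbit_dist G v w"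
    using G(2) maximin_value_attained[of G v] by blast
  \<comment> \<open>Since \<open>transpose A ** B\<close> lies in \<open>G\<close> again, sign
    conditions against the whole orbit are \<open>G\<close>-invariant; this serves both
    \<open>S\<close> and \<open>V\<close> below.\<close>
  have moved: "(A *v x) \<bullet> (B *v v) = x \<bullet> ((transpose A ** B) *v v)" for A B x
    by (simp add: inner_matrix_vector_transpose matrix_vector_mul_assoc)
  define S where "S = sphere 0 1 \<inter> (\<Inter>A\<in>G. {x. x \<bullet> (A *v v) \<le> 0})"
  have "w \<bullet> (A *v v) \<le> 0" if "A \<in> G" for A
  proof -
    have "sqrt 2 \<le> norm (w - A *v v)"
      using orbit_dist_le[OF that, of v w] * w by simp
    then show ?thesis
      using w v G(1)[OF that] by (simp add: norm_diff_unit_vectors_ge_sqrt2_iff orthogonal_matrix_norm)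
  qed
  then have "w \<in> S" using w by (auto simp: S_def)
  have "compact S"
    unfolding S_def
    by (intro compact_Int_closed compact_sphere closed_INT ballI)
       (simp add: closed_halfspace_le inner_commute[of _ "_ *v v"])
  have S_inv: "(\<lambda>x. A *v x) ` S \<subseteq> S" if "A \<in> G" for A
    using that G by (auto simp: S_def orthogonal_matrix_norm moved)
  \<comment> \<open>Linear maps commute with convex hulls, so the invariance of \<open>S\<close>
    passes to its hull.\<close>
  have "A *v x \<in> convex hull S" if "A \<in> G" "x \<in> convex hull S" for A x
    using that S_inv[OF that(1)] hull_mono[of "(\<lambda>x. A *v x) ` S" S convex]
      convex_hull_linear_image[of "(\<lambda>x. A *v x)" S] by auto
  then obtain c where "c \<in> convex hull S" "\<And>A. A \<in> G \<Longrightarrow> A *v c = c"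
    using compact_convex_invariant_fixed_point[of G "convex hull S"] G(1) \<open>w \<in> S\<close>
      compact_convex_hull[OF \<open>compact S\<close>] convex_convex_hull by (metis convex_hull_eq_empty empty_iff)
  then have "0 \<in> convex hull S" using irreducible_fixed_vector_eq_0[OF assms(1-3)] by metis
  then obtain y where y: "y \<in> S" "\<And>b. b \<in> (\<lambda>A. A *v v) ` G \<Longrightarrow> y \<bullet> b = 0"
    by (rule convex_hull_nonpos_zero[where B = "(\<lambda>A. A *v v) ` G"]) (auto simp: S_def)
  define V where "V = {x. \<forall>A\<in>G. x \<bullet> (A *v v) = 0}"
  have "subspace V" by (auto simp: V_def subspace_def inner_add_left)
  moreover have "(\<lambda>x. A *v x) ` V \<subseteq> V" if "A \<in> G" for A
    using that G by (auto simp: V_def moved)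
  \<comment> \<open>\<open>S\<close> lies on the unit sphere, so \<open>y\<close> is nonzero even
    though 0 is in the hull of \<open>S\<close>.\<close>
  moreover have "y \<in> V" "y \<noteq> 0" using y by (auto simp: V_def S_def)
  ultimately have "V = UNIV" using assms(3) unfolding irreducible_action_def by blast
  \<comment> \<open>The identity puts \<open>v\<close> in its own orbit, so \<open>v\<close> would
    be orthogonal to itself.\<close>
  then have "v \<in> V" by simp
  then have "v \<bullet> (mat 1 *v v) = 0" using G(2) unfolding V_def by blast
  then show False using v by simp
qed

theorem theorem2:
  fixes G :: "(real^'n^'n) set"
  assumes "subgroup G orthogonal_group"
    and "CARD('n) \<ge> 2 \<or> G \<noteq> {mat 1}"
  shows "irreducible_action G \<longleftrightarrow> (\<forall>v\<in>sphere 0 1. maximin_value G v < sqrt 2)"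
proof
  assume "irreducible_action G"
  then show "\<forall>v\<in>sphere 0 1. maximin_value G v < sqrt 2"
    using irreducible_maximin_value_less[OF assms] by simp
next
  assume *: "\<forall>v\<in>sphere 0 1. maximin_value G v < sqrt 2"
  show "irreducible_action G"
  proof (rule ccontr)
    assume "\<not> irreducible_action G"
    then obtain v where "norm v = 1" "sqrt 2 \<le> maximin_value G v"
      using reducible_maximin_value_ge[OF assms(1)] by blast
    with * show False by force
  qed
qed

end
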